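(* In the two-stage settlement electricity market, there exists a unique Nash equilibrium of the load-side Cournot game with virtual bidders, with loads $\mathcal L=\{1,\dots,L\}$, $L\ge 1$, and virtual bidders $\mathcal V=\{1,\dots,V\}$, and at this equilibrium the virtual bids are given by $$d_v^{DA*}=\frac{\alpha^{DA}}{(L+V+1)\alpha^{RT}}\sum_{l\in\mathcal L}d_l,\qquad d_v^{RT*}=-\frac{\alpha^{DA}}{(L+V+1)\alpha^{RT}}\sum_{l\in\mathcal L}d_l$$ for all $v\in\mathcal V$.
   Context: Let $\mathcal F$ (fast-responsive generators) and $\mathcal S$ (slow-responsive generators) be nonempty finite sets, with cost coefficients $\alpha_i^f>0,\ \beta_i^f\in\mathbb R$ for $i\in\mathcal F$ and $\alpha_j^s>0,\ \beta_j^s\in\mathbb R$ for $j\in\mathcal S$ (quadratic costs $\frac{\alpha}{2}x^2+\beta x$). Define $$\alpha^{DA}=\Big(\sum_{i\in\mathcal F}\tfrac1{\alpha_i^f}+\sum_{j\in\mathcal S}\tfrac1{\alpha_j^s}\Big)^{-1},\quad \beta^{DA}=\alpha^{DA}\Big(\sum_{i\in\mathcal F}\tfrac{\beta_i^f}{\alpha_i^f}+\sum_{j\in\mathcal S}\tfrac{\beta_j^s}{\alpha_j^s}\Big),\quad \alpha^{RT}=\Big(\sum_{i\in\mathcal F}\tfrac1{\alpha_i^f}\Big)^{-1}.$$ In particular $\alpha^{RT}>\alpha^{DA}>0$. (Generator nonnegativity constraints are assumed throughout not to be binding, so the price formulas below hold.) Load-side Cournot game with virtual bidders. The players are the loads $l\in\mathcal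 L$ together with the virtual bidders $v\in\mathcal V$ (the two index sets being regarded as disjoint). Load $l\in\mathcal L$ has inelastic demand $d_l\ge 0$, with $\sum_{l\in\mathcal L}d_l>0$; each virtual bidder acts as a load with zero demand, $d_v=0$ for $v\in\mathcal V$. A strategy of player $p\in\mathcal L\cup\mathcal V$ is a pair $\vec d_p=(d_p^{DA},d_p^{RT})$ of real numbers with $d_p^{DA}\ge 0$ and $d_p^{DA}+d_p^{RT}=d_p$ (so $d_p^{RT}$ may have any sign). Given a strategy profile $\vec d$, put $d^{DA}=\sum_{p\in\mathcal L\cup\mathcal V}d_p^{DA}$, $d^{RT}=\sum_{p\in\mathcal L\cup\mathcal V}d_p^{RT}$; the day-ahead and real-time prices are $$\lambda^{DA}(\vec d)=\alpha^{DA}d^{DA}+\beta^{DA},\qquad \lambda^{RT}(\vec d)=\alpha^{RT}d^{RT}+\lambda^{DA}(\vec d).$$ The cost of player $p$ is $c_p(\vec d_p;\vec d_{-p})=\lambda^{DA}(\vec d)\,d_p^{DA}+\lambda^{RT}(\vec d)\,d_p^{RT}$, where $\vec d_{-p}$ denotes the strategies of all other players. A profile $\vec d^*$ of strategies is a Nash equilibrium if $c_p(\vec d^*_p;\vec d^*_{-p})\le c_p(\vec d_p;\vec d^*_{-p})$ for every strategy $\vec d_p$ of player $p$ and every player $p$. *)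

theory Defs
  imports Complex_Main "HOL-Library.FuncSet"
begin

text \<open>Fast- and slow-responsive generators with quadratic costs
  \<open>\<alpha>/2 * x\<^sup>2 + \<beta> * x\<close>.\<close>

record ('f, 's) generators =
  fast :: "'f set"
  slow :: "'s set"
  fast_alpha :: "'f \<Rightarrow> real"
  fast_beta :: "'f \<Rightarrow> real"
  slow_alpha :: "'s \<Rightarrow> real"
  slow_beta :: "'s \<Rightarrow> real"

definition alpha_DA :: "('f, 's) generators \<Rightarrow> real" where
  "alpha_DA G = inverse
     ((\<Sum>i\<in>fast G. 1 / fast_alpha G i) + (\<Sum>j\<in>slow G. 1 / slow_alpha G j))"

definition beta_DA :: "('f, 's) generators \<Rightarrow> real" where
  "beta_DA G = alpha_DA G *
     ((\<Sum>i\<in>fast G. fast_beta G i / fast_alpha G i)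
      + (\<Sum>j\<in>slow G. slow_beta G j / slow_alpha G j))"

definition alpha_RT :: "('f, 's) generators \<Rightarrow> real" where
  "alpha_RT G = inverse (\<Sum>i\<in>fast G. 1 / fast_alpha G i)"

text \<open>\<open>Inl l\<close> is load \<open>l\<close> and \<open>Inr v\<close> is virtual bidder \<open>v\<close>.
  A strategy is a pair (day-ahead quantity, real-time quantity).\<close>

type_synonym player = "nat + nat"
type_synonym profile = "player \<Rightarrow> real \<times> real"

definition players :: "nat \<Rightarrow> nat \<Rightarrow> player set" where
  "players L V = {1..L} <+> {1..V}"

definition demand :: "(nat \<Rightarrow> real) \<Rightarrow> player \<Rightarrow> real" where
  "demand d p = (case p of Inl l \<Rightarrow> d l | Inr v \<Rightarrow> 0)"

definition strategies :: "(nat \<Rightarrow> real) \<Rightarrow> player \<Rightarrow> (real \<times> real) set" where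
  "strategies d p = {(x, y). 0 \<le> x \<and> x + y = demand d p}"

text \<open>Profiles are extensional outside the set of players, so that equality of profiles, and hence
  uniqueness of an equilibrium, concerns the strategies of the actual players only.\<close>

definition profiles :: "nat \<Rightarrow> nat \<Rightarrow> (nat \<Rightarrow> real) \<Rightarrow> profile set" where
  "profiles L V d = (\<Pi>\<^sub>E p\<in>players L V. strategies d p)"

definition price_DA :: "('f, 's) generators \<Rightarrow> nat \<Rightarrow> nat \<Rightarrow> profile \<Rightarrow> real" where
  "price_DA G L V \<sigma> = alpha_DA G * (\<Sum>p\<in>players L V. fst (\<sigma> p)) + beta_DA G"

definition price_RT :: "('f, 's) generators \<Rightarrow> nat \<Rightarrow> nat \<Rightarrow> profile \<Rightarrow> real" where
  "price_RT G L V \<sigma> = alpha_RT G * (\<Sum>p\<in>players L V. snd (\<sigma> p)) + price_DA G L V \<sigma>"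

definition cost :: "('f, 's) generators \<Rightarrow> nat \<Rightarrow> nat \<Rightarrow> profile \<Rightarrow> player \<Rightarrow> real" where
  "cost G L V \<sigma> p = price_DA G L V \<sigma> * fst (\<sigma> p) + price_RT G L V \<sigma> * snd (\<sigma> p)"

definition nash_equilibrium ::
  "('f, 's) generators \<Rightarrow> nat \<Rightarrow> nat \<Rightarrow> (nat \<Rightarrow> real) \<Rightarrow> profile \<Rightarrow> bool" where
  "nash_equilibrium G L V d \<sigma> \<longleftrightarrow>
     \<sigma> \<in> profiles L V d \<and>
     (\<forall>p\<in>players L V. \<forall>s\<in>strategies d p. cost G L V \<sigma> p \<le> cost G L V (\<sigma>(p := s)) p)"

end

theory Submission
  imports Defs
begin

text \<open>On the budget line \<open>x + y = d\<^sub>p\<close> the cost of player \<open>p\<close> is a quadratic in its day-ahead quantity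
  \<open>x\<close> with leading coefficient \<open>\<alpha>\<^sup>R\<^sup>T > 0\<close>. Write \<open>k = \<alpha>\<^sup>D\<^sup>A / \<alpha>\<^sup>R\<^sup>T < 1\<close>, and let \<open>D\<close> and \<open>T\<close> be the total
  day-ahead quantity and the total demand. The equilibrium condition is the complementarity condition
  \<open>g\<^sub>p \<ge> 0\<close>, \<open>x\<^sub>p * g\<^sub>p = 0\<close>, where \<open>g\<^sub>p = x\<^sub>p + D - T - (1 - k) * d\<^sub>p\<close>. Were \<open>D \<ge> T\<close>, it would give
  \<open>x\<^sub>p \<le> (1 - k) * d\<^sub>p\<close> for every \<open>p\<close>, hence \<open>D \<le> (1 - k) * T < T\<close>. So \<open>D < T\<close>, which forces
  \<open>g\<^sub>p = 0\<close> for all \<open>p\<close>, and this linear system has exactly one solution.\<close>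

text \<open>The expression is the increment from \<open>x\<close> to \<open>z\<close> of a convex
  quadratic with derivative \<open>g\<close> at \<open>x\<close>, so the right-hand side is its KKT
  condition for the constraint \<open>z \<ge> 0\<close>.\<close>

lemma quadratic_min_on_nonneg_iff:
  fixes x g :: real
  assumes "x \<ge> 0"
  shows "(\<forall>z\<ge>0. 0 \<le> (z - x)\<^sup>2 + g * (z - x)) \<longleftrightarrow> g \<ge> 0 \<and> x * g = 0"
proof
  assume *: "\<forall>z\<ge>0. 0 \<le> (z - x)\<^sup>2 + g * (z - x)"
  have g: "g \<ge> 0"
  proof (rule ccontr)
    assume "\<not> g \<ge> 0"
    then have neg: "g < 0" by simp
    \<comment> \<open>The test point \<open>x - g / 2\<close> is the unconstrained minimiser; it is
      feasible because \<open>g < 0\<close>.\<close>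
    have "0 \<le> (x - g / 2 - x)\<^sup>2 + g * (x - g / 2 - x)"
      using * assms neg by (intro *[rule_format]) simp
    also have "\<dots> = - (g * g) / 4" by (simp add: power2_eq_square field_simps)
    finally show False using mult_neg_neg[OF neg neg] by simp
  qed
  moreover have "x * g = 0"
  proof (rule ccontr)
    assume "x * g \<noteq> 0"
    then have pos: "x > 0" "g > 0" using g assms by auto
    \<comment> \<open>A step \<open>m\<close> to the left: the cap \<open>x\<close> keeps it
      feasible, the cap \<open>g / 2\<close> makes the increment \<open>m * (m - g)\<close>
      negative.\<close>
    define m where "m = min x (g / 2)"
    have m: "0 < m" "m \<le> x" "m < g" using pos by (auto simp: m_def min_def)
    have "0 \<le> (x - m - x)\<^sup>2 + g * (x - m - x)"
      using m by (intro *[rule_format]) simp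
    also have "\<dots> = m * (m - g)" by (simp add: power2_eq_square algebra_simps)
    finally show False using m by (simp add: zero_le_mult_iff)
  qed
  ultimately show "g \<ge> 0 \<and> x * g = 0" by simp
next
  assume g: "g \<ge> 0 \<and> x * g = 0"
  show "\<forall>z\<ge>0. 0 \<le> (z - x)\<^sup>2 + g * (z - x)"
  proof (intro allI impI)
    fix z :: real assume z: "z \<ge> 0"
    have "g * (z - x) = g * z" using g by (auto simp: algebra_simps)
    moreover have "g * z \<ge> 0" using g z by simp
    ultimately show "0 \<le> (z - x)\<^sup>2 + g * (z - x)"
      by (simp only: add_nonneg_nonneg zero_le_power2)
  qed
qed

text \<open>Once every condition holds with equality, summing over \<open>P\<close> gives
  \<open>(card P + 1) * (T - sum x P) = k * T\<close>; this determines the total and then each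
  \<open>x p\<close>.\<close>

lemma complementarity_solution:
  fixes x d :: "'a \<Rightarrow> real" and k T :: real
  assumes P: "finite P" and T: "T = sum d P" "T > 0" and d: "\<And>p. p \<in> P \<Longrightarrow> d p \<ge> 0"
    and k: "0 < k" "k < 1" and x: "\<And>p. p \<in> P \<Longrightarrow> x p \<ge> 0"
  shows "(\<forall>p\<in>P. x p + sum x P - T - (1 - k) * d p \<ge> 0 \<and>
                 x p * (x p + sum x P - T - (1 - k) * d p) = 0) \<longleftrightarrow>
         (\<forall>p\<in>P. x p = k * T / (card P + 1) + (1 - k) * d p)"
    (is "?compl \<longleftrightarrow> ?sol")
proof
  assume c: ?compl
  have lt: "sum x P < T"
  proof (rule ccontr)
    assume "\<not> sum x P < T"
    then have ge: "sum x P \<ge> T" by simp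
    \<comment> \<open>At \<open>x p = 0\<close> the bound is nonnegative; otherwise complementarity
      gives \<open>x p = T - sum x P + (1 - k) * d p\<close> with
      \<open>T - sum x P \<le> 0\<close>.\<close>
    have "x p \<le> (1 - k) * d p" if p: "p \<in> P" for p
    proof (cases "x p = 0")
      case True
      then show ?thesis using d[OF p] k by simp
    next
      case False
      then show ?thesis using c p ge by force
    qed
    then have "sum x P \<le> (1 - k) * T"
      unfolding T(1) sum_distrib_left by (rule sum_mono)
    also have "\<dots> < T" using k T(2) by (simp add: algebra_simps)
    finally show False using ge by simp
  qed
  have eq: "x p = T - sum x P + (1 - k) * d p" if p: "p \<in> P" for p
  proof -
    have "(1 - k) * d p \<ge> 0" using d[OF p] k by simp
    \<comment> \<open>At \<open>x p = 0\<close> the expression required to be nonnegative would be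
      at most \<open>sum x P - T < 0\<close>.\<close>
    then have "x p \<noteq> 0" using bspec[OF c p] lt by auto
    then show ?thesis using bspec[OF c p] by simp
  qed
  have "sum x P = (\<Sum>p\<in>P. T - sum x P + (1 - k) * d p)"
    using eq by (intro sum.cong) auto
  also have "\<dots> = card P * (T - sum x P) + (1 - k) * T"
    unfolding T(1) by (simp add: sum.distrib sum_distrib_left)
  finally have "T - sum x P = k * T / (card P + 1)"
    by (simp add: field_simps)
  then show ?sol using eq by simp
next
  assume s: ?sol
  have "sum x P = (\<Sum>p\<in>P. k * T / (card P + 1) + (1 - k) * d p)"
    using s by (intro sum.cong) auto
  also have "\<dots> = card P * (k * T / (card P + 1)) + (1 - k) * T"
    unfolding T(1) by (simp add: sum.distrib sum_distrib_left)
  also have "\<dots> = T - k * T / (card P + 1)"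
    by (simp add: divide_simps) (simp add: algebra_simps)
  finally show ?compl using s by simp
qed

lemma finite_players [simp]: "finite (players L V)"
  by (simp add: players_def)

lemma card_players [simp]: "card (players L V) = L + V"
  by (simp add: players_def card_Plus)

lemma sum_demand_players: "(\<Sum>p\<in>players L V. demand d p) = (\<Sum>l\<in>{1..L}. d l)"
  by (simp add: players_def sum.Plus demand_def)

lemma demand_nonneg:
  assumes "\<And>l. l \<in> {1..L} \<Longrightarrow> d l \<ge> 0" "p \<in> players L V"
  shows "demand d p \<ge> 0"
  using assms by (auto simp: players_def demand_def)

text \<open>The budget line fixes the real-time quantity, so a strategy amounts to a nonnegative
  day-ahead quantity.\<close>

lemma ball_strategies_fst: "(\<forall>s\<in>strategies d p. Q (fst s)) \<longleftrightarrow> (\<forall>z\<ge>0. Q z)"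
proof
  assume *: "\<forall>s\<in>strategies d p. Q (fst s)"
  show "\<forall>z\<ge>0. Q z"
  proof (intro allI impI)
    fix z :: real assume "z \<ge> 0"
    then show "Q z"
      using bspec[OF *, of "(z, demand d p - z)"] by (simp add: strategies_def)
  qed
qed (auto simp: strategies_def)

text \<open>The slow generators add a positive amount to the sum that is inverted; the strict
  inequality later supplies \<open>k < 1\<close>.\<close>

lemma alpha_DA_pos_less_alpha_RT:
  assumes "finite (fast G)" "fast G \<noteq> {}" "finite (slow G)" "slow G \<noteq> {}"
    and "\<And>i. i \<in> fast G \<Longrightarrow> fast_alpha G i > 0"
    and "\<And>j. j \<in> slow G \<Longrightarrow> slow_alpha G j > 0"
  shows "0 < alpha_DA G" "alpha_DA G < alpha_RT G"
proof -
  have "(\<Sum>i\<in>fast G. 1 / fast_alpha G i) > 0" "(\<Sum>j\<in>slow G. 1 / slow_alpha G j) > 0"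
    using assms by (auto intro!: sum_pos)
  then show "0 < alpha_DA G" "alpha_DA G < alpha_RT G"
    by (auto simp: alpha_DA_def alpha_RT_def intro: less_imp_inverse_less)
qed

lemma sum_fun_upd:
  fixes h :: "'b \<Rightarrow> 'c :: ab_group_add"
  assumes "finite P" "p \<in> P"
  shows "(\<Sum>q\<in>P. h ((\<sigma>(p := s)) q)) = (\<Sum>q\<in>P. h (\<sigma> q)) + h s - h (\<sigma> p)"
proof -
  have "(\<Sum>q\<in>P - {p}. h ((\<sigma>(p := s)) q)) = (\<Sum>q\<in>P - {p}. h (\<sigma> q))"
    by (rule sum.cong) auto
  then show ?thesis
    using assms by (simp add: sum.remove[of P p] algebra_simps)
qed

lemma profiles_sum_snd:
  assumes "\<sigma> \<in> profiles L V d"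
  shows "(\<Sum>q\<in>players L V. snd (\<sigma> q)) =
    (\<Sum>l\<in>{1..L}. d l) - (\<Sum>q\<in>players L V. fst (\<sigma> q))"
proof -
  have "(\<Sum>q\<in>players L V. snd (\<sigma> q)) = (\<Sum>q\<in>players L V. demand d q - fst (\<sigma> q))"
    using assms by (intro sum.cong) (auto simp: profiles_def strategies_def dest!: PiE_mem)
  then show ?thesis by (simp add: sum_subtractf sum_demand_players)
qed

text \<open>On the budget line the cost is
  \<open>price_DA * d_p + alpha_RT * (T - D) * (d_p - x)\<close>. Moving \<open>x\<close>, and with
  it \<open>D\<close>, by the same amount changes the first term linearly and the second
  quadratically; \<open>beta_DA\<close> cancels.\<close>

lemma cost_deviation:
  fixes G :: "('f, 's) generators"
  assumes \<sigma>: "\<sigma> \<in> profiles L V d" and p: "p \<in> players L V" and s: "s \<in> strategies d p"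
    and r: "alpha_RT G \<noteq> 0"
  shows "cost G L V (\<sigma>(p := s)) p - cost G L V \<sigma> p = alpha_RT G *
    ((fst s - fst (\<sigma> p))\<^sup>2 +
     (fst (\<sigma> p) + (\<Sum>q\<in>players L V. fst (\<sigma> q)) - (\<Sum>l\<in>{1..L}. d l)
        - (1 - alpha_DA G / alpha_RT G) * demand d p) * (fst s - fst (\<sigma> p)))"
proof -
  have "\<sigma> p \<in> strategies d p"
    using \<sigma> p by (auto simp: profiles_def)
  then have snds: "snd (\<sigma> p) = demand d p - fst (\<sigma> p)" "snd s = demand d p - fst s"
    using s by (auto simp: strategies_def)
  \<comment> \<open>Replacing \<open>alpha_DA G\<close> by \<open>alpha_RT G * k\<close> turns the
    goal into a polynomial identity without division.\<close>
  define k where "k = alpha_DA G / alpha_RT G"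
  have a: "alpha_DA G = alpha_RT G * k"
    using r by (simp add: k_def)
  have sums:
    "(\<Sum>q\<in>players L V. fst ((\<sigma>(p := s)) q)) =
       (\<Sum>q\<in>players L V. fst (\<sigma> q)) + fst s - fst (\<sigma> p)"
    "(\<Sum>q\<in>players L V. snd ((\<sigma>(p := s)) q)) =
       (\<Sum>l\<in>{1..L}. d l) - (\<Sum>q\<in>players L V. fst (\<sigma> q)) - fst s + fst (\<sigma> p)"
    using p profiles_sum_snd[OF \<sigma>] snds by (simp_all only: sum_fun_upd finite_players)
  show ?thesis
    unfolding cost_def price_RT_def price_DA_def sums profiles_sum_snd[OF \<sigma>] fun_upd_same snds
      k_def[symmetric]
    unfolding a
    by (simp add: power2_eq_square algebra_simps)
qed

text \<open>Each player's best-response condition becomes complementarity, and the joint system is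
  then solved. Only day-ahead quantities appear, since membership in \<open>profiles\<close> fixes
  the real-time ones.\<close>

lemma nash_equilibrium_iff:
  fixes G :: "('f, 's) generators"
  assumes \<alpha>: "0 < alpha_DA G" "alpha_DA G < alpha_RT G"
    and d: "\<And>l. l \<in> {1..L} \<Longrightarrow> d l \<ge> 0" and T: "(\<Sum>l\<in>{1..L}. d l) > 0"
  shows "nash_equilibrium G L V d \<sigma> \<longleftrightarrow> \<sigma> \<in> profiles L V d \<and>
    (\<forall>p\<in>players L V. fst (\<sigma> p) =
       alpha_DA G / alpha_RT G * (\<Sum>l\<in>{1..L}. d l) / (L + V + 1) +
       (1 - alpha_DA G / alpha_RT G) * demand d p)"
proof (cases "\<sigma> \<in> profiles L V d")
  case \<sigma>: True
  \<comment> \<open>Up to the factor \<open>alpha_RT G\<close>, this is the marginal cost to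
    \<open>p\<close> of its own day-ahead quantity.\<close>
  define g where "g p = fst (\<sigma> p) + (\<Sum>q\<in>players L V. fst (\<sigma> q)) - (\<Sum>l\<in>{1..L}. d l)
    - (1 - alpha_DA G / alpha_RT G) * demand d p" for p
  have x: "fst (\<sigma> p) \<ge> 0" if "p \<in> players L V" for p
    using \<sigma> that by (auto simp: profiles_def strategies_def dest!: PiE_mem)
  have "(\<forall>s\<in>strategies d p. cost G L V \<sigma> p \<le> cost G L V (\<sigma>(p := s)) p) \<longleftrightarrow>
      g p \<ge> 0 \<and> fst (\<sigma> p) * g p = 0" (is "?best \<longleftrightarrow> _") if p: "p \<in> players L V" for p
  proof -
    have "cost G L V \<sigma> p \<le> cost G L V (\<sigma>(p := s)) p \<longleftrightarrow>
        0 \<le> (fst s - fst (\<sigma> p))\<^sup>2 + g p * (fst s - fst (\<sigma> p))"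
      if "s \<in> strategies d p" for s
    proof -
      have "cost G L V \<sigma> p \<le> cost G L V (\<sigma>(p := s)) p \<longleftrightarrow>
          0 \<le> alpha_RT G * ((fst s - fst (\<sigma> p))\<^sup>2 + g p * (fst s - fst (\<sigma> p)))"
        using cost_deviation[OF \<sigma> p that, of G] \<alpha> unfolding g_def[symmetric] by linarith
      then show ?thesis using \<alpha> by (simp add: zero_le_mult_iff)
    qed
    then have "?best \<longleftrightarrow>
        (\<forall>s\<in>strategies d p. 0 \<le> (fst s - fst (\<sigma> p))\<^sup>2 + g p * (fst s - fst (\<sigma> p)))"
      by blast
    also have "\<dots> \<longleftrightarrow> (\<forall>z\<ge>0. 0 \<le> (z - fst (\<sigma> p))\<^sup>2 + g p * (z - fst (\<sigma> p)))"
      by (rule ball_strategies_fst)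
    also have "\<dots> \<longleftrightarrow> g p \<ge> 0 \<and> fst (\<sigma> p) * g p = 0"
      by (rule quadratic_min_on_nonneg_iff[OF x[OF p]])
    finally show ?thesis .
  qed
  then have "nash_equilibrium G L V d \<sigma> \<longleftrightarrow>
      (\<forall>p\<in>players L V. g p \<ge> 0 \<and> fst (\<sigma> p) * g p = 0)"
    using \<sigma> by (simp add: nash_equilibrium_def)
  also have "\<dots> \<longleftrightarrow> (\<forall>p\<in>players L V. fst (\<sigma> p) =
       alpha_DA G / alpha_RT G * (\<Sum>l\<in>{1..L}. d l) / (card (players L V) + 1) +
       (1 - alpha_DA G / alpha_RT G) * demand d p)"
    unfolding g_def using \<alpha> T x demand_nonneg[OF d]
    by (intro complementarity_solution) (auto simp: sum_demand_players)
  finally show ?thesis using \<sigma> by simp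
qed (simp add: nash_equilibrium_def)

theorem theorem4:
  fixes G :: "('f, 's) generators"
    and L V :: nat
    and d :: "nat \<Rightarrow> real"
  assumes "finite (fast G)" and "fast G \<noteq> {}"
    and "finite (slow G)" and "slow G \<noteq> {}"
    and "\<And>i. i \<in> fast G \<Longrightarrow> fast_alpha G i > 0"
    and "\<And>j. j \<in> slow G \<Longrightarrow> slow_alpha G j > 0"
    and "L \<ge> 1"
    and "\<And>l. l \<in> {1..L} \<Longrightarrow> d l \<ge> 0"
    and "(\<Sum>l\<in>{1..L}. d l) > 0"
  shows "(\<exists>!\<sigma>. nash_equilibrium G L V d \<sigma>) \<and>
    (\<forall>\<sigma>. nash_equilibrium G L V d \<sigma> \<longrightarrow>
      (\<forall>v\<in>{1..V}.
        fst (\<sigma> (Inr v)) =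
          alpha_DA G / ((real L + real V + 1) * alpha_RT G) * (\<Sum>l\<in>{1..L}. d l) \<and>
        snd (\<sigma> (Inr v)) =
          - (alpha_DA G / ((real L + real V + 1) * alpha_RT G)) * (\<Sum>l\<in>{1..L}. d l)))"
proof -
  note \<alpha> = alpha_DA_pos_less_alpha_RT[OF assms(1-6)]
  note iff = nash_equilibrium_iff[OF \<alpha> assms(8,9)]
  define x where "x p = alpha_DA G / alpha_RT G * (\<Sum>l\<in>{1..L}. d l) / (L + V + 1) +
    (1 - alpha_DA G / alpha_RT G) * demand d p" for p
  \<comment> \<open>The restricted lambda makes the candidate extensional, as
    \<open>profiles\<close> demands.\<close>
  define \<tau> where "\<tau> = (\<lambda>p\<in>players L V. (x p, demand d p - x p))"
  \<comment> \<open>Feasibility of the closed form: both summands are nonnegative because the ratio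
    of the two slopes lies between 0 and 1.\<close>
  have "x p \<ge> 0" if "p \<in> players L V" for p
    using \<alpha> assms(9) demand_nonneg[OF assms(8) that] by (simp add: x_def)
  then have \<tau>: "\<tau> \<in> profiles L V d"
    by (auto simp: \<tau>_def profiles_def strategies_def)
  have eq: "\<sigma> = \<tau>" if "nash_equilibrium G L V d \<sigma>" for \<sigma>
  proof (rule PiE_ext)
    have \<sigma>: "\<sigma> \<in> profiles L V d" "\<forall>p\<in>players L V. fst (\<sigma> p) = x p"
      using that iff by (simp_all add: x_def)
    then show "\<sigma> \<in> Pi\<^sub>E (players L V) (strategies d)" "\<tau> \<in> Pi\<^sub>E (players L V) (strategies d)"
      using \<tau> by (simp_all add: profiles_def)
    fix p assume p: "p \<in> players L V"
    then have "\<sigma> p \<in> strategies d p" using \<sigma>(1) by (auto simp: profiles_def)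
    then show "\<sigma> p = \<tau> p"
      using \<sigma>(2) p by (auto simp: \<tau>_def strategies_def prod_eq_iff)
  qed
  have nash: "nash_equilibrium G L V d \<tau>"
    using iff \<tau> by (simp add: \<tau>_def x_def)
  have "\<exists>!\<sigma>. nash_equilibrium G L V d \<sigma>"
    using nash eq by blast
  moreover have
    "fst (\<tau> (Inr v)) =
       alpha_DA G / ((real L + real V + 1) * alpha_RT G) * (\<Sum>l\<in>{1..L}. d l)"
    "snd (\<tau> (Inr v)) =
       - (alpha_DA G / ((real L + real V + 1) * alpha_RT G)) * (\<Sum>l\<in>{1..L}. d l)"
    if "v \<in> {1..V}" for v
  proof -
    \<comment> \<open>A virtual bidder has zero demand, so only the first summand of
      \<open>x\<close> survives and the real-time bid is its negative.\<close>
    have "Inr v \<in> players L V" using that by (auto simp: players_def)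
    then show
      "fst (\<tau> (Inr v)) =
         alpha_DA G / ((real L + real V + 1) * alpha_RT G) * (\<Sum>l\<in>{1..L}. d l)"
      "snd (\<tau> (Inr v)) =
         - (alpha_DA G / ((real L + real V + 1) * alpha_RT G)) * (\<Sum>l\<in>{1..L}. d l)"
      by (simp_all add: \<tau>_def x_def demand_def mult.commute)
  qed
  ultimately show ?thesis using eq by blast
qed

end
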